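(* Let $G=(V,E)$ be a finite connected Eulerian directed graph of diameter $D$. For the simple rotor walk $(X_t)_{t\ge 0}$ on $G$ with any rotor mechanism $m$ and any initial rotor configuration $\rho$, the vertex cover time $t_{vertex}=\min\{t : \{X_1,\dots,X_t\}=V\}$ and the edge cover time $t_{edge}=\min\{t : \{(X_s,X_{s+1}) : 0\le s\le t\}=E\}$ satisfy $$t_{vertex}\le D\,\#E\qquad\text{and}\qquad t_{edge}\le (D+1)\,\#E.$$
   Context: $\#E$ is the number of directed edges of $G=(V,E)$. $G$ is Eulerian if $\mathrm{indeg}(v)=\mathrm{outdeg}(v)$ for all $v\in V$. The diameter $D$ is the maximum over ordered pairs $(x,y)$ of vertices of the length of a shortest directed path from $x$ to $y$ (a finite connected Eulerian directed graph is strongly connected). For $v\in V$, $E_v$ is the set of outgoing edges of $v$. A rotor configuration is a choice of $\rho(v)\in E_v$ for each $v$. A rotor mechanism is a choice, for each $v$, of a cyclic permutation $m(v)$ of $E_v$ (a single cycle through all of $E_v$). Given $\rho$, $m$ and a starting vertex $X_0$, the simple rotor walk is the sequence of vertices $X_0,X_1,\dots$ and rotor configurations $\rho_0=\rho,\rho_1,\dots$ such that for all $t\ge0$: $\rho_{t+1}(X_t)=m(X_t)(\rho_t(X_t))$, $\rho_{t+1}(v)=\rho_t(v)$ for $v\ne X_t$, and $X_{t+1}$ is the target of the edge $\rho_{t+1}(X_t)$.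
   Formalization: The bound on the vertex cover time is stated for graphs with at least two vertices: on a single vertex with loops D = 0, but {X_1,…,X_t} = V first holds at t = 1, so the bound fails there. *)

theory Defs
  imports
    "Graph_Theory.Graph_Theory"
    "HOL-Combinatorics.Orbits"
    "HOL-Library.Extended_Nat"
begin

text \<open>
  Digraphs are those of the library's \<^typ>\<open>('a, 'b) pre_digraph\<close>, with arcs as objects of their
  own: loops and parallel arcs are allowed.
\<close>

definition eulerian_digraph :: "('a, 'b) pre_digraph \<Rightarrow> bool" where
  "eulerian_digraph G \<longleftrightarrow> (\<forall>v \<in> verts G. in_degree G v = out_degree G v)"

definition digraph_dist :: "('a, 'b) pre_digraph \<Rightarrow> 'a \<Rightarrow> 'a \<Rightarrow> enat" where
  "digraph_dist G x y = (INF p \<in> {p. pre_digraph.awalk G x p y}. enat (length p))"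

definition digraph_diameter :: "('a, 'b) pre_digraph \<Rightarrow> enat" where
  "digraph_diameter G = (SUP x \<in> verts G. SUP y \<in> verts G. digraph_dist G x y)"

definition rotor_configuration :: "('a, 'b) pre_digraph \<Rightarrow> ('a \<Rightarrow> 'b) \<Rightarrow> bool" where
  "rotor_configuration G \<rho> \<longleftrightarrow> (\<forall>v \<in> verts G. \<rho> v \<in> out_arcs G v)"

text \<open>
  \<^const>\<open>cyclic_on\<close> says that the out-arcs of \<open>v\<close> form one single orbit of \<open>m v\<close>; in particular
  \<open>m v\<close> restricts to a bijection of that set. Its values elsewhere are irrelevant.
\<close>

definition rotor_mechanism :: "('a, 'b) pre_digraph \<Rightarrow> ('a \<Rightarrow> 'b \<Rightarrow> 'b) \<Rightarrow> bool" where
  "rotor_mechanism G m \<longleftrightarrow> (\<forall>v \<in> verts G. cyclic_on (m v) (out_arcs G v))"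

primrec rotor_state ::
  "('a, 'b) pre_digraph \<Rightarrow> ('a \<Rightarrow> 'b \<Rightarrow> 'b) \<Rightarrow> ('a \<Rightarrow> 'b) \<Rightarrow> 'a \<Rightarrow> nat \<Rightarrow> 'a \<times> ('a \<Rightarrow> 'b)"
where
  "rotor_state G m \<rho> x0 0 = (x0, \<rho>)"
| "rotor_state G m \<rho> x0 (Suc t) =
    (let (x, r) = rotor_state G m \<rho> x0 t; e = m x (r x) in (head G e, r(x := e)))"

definition rotor_walk ::
  "('a, 'b) pre_digraph \<Rightarrow> ('a \<Rightarrow> 'b \<Rightarrow> 'b) \<Rightarrow> ('a \<Rightarrow> 'b) \<Rightarrow> 'a \<Rightarrow> nat \<Rightarrow> 'a" where
  "rotor_walk G m \<rho> x0 t = fst (rotor_state G m \<rho> x0 t)"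

definition rotor_config_at ::
  "('a, 'b) pre_digraph \<Rightarrow> ('a \<Rightarrow> 'b \<Rightarrow> 'b) \<Rightarrow> ('a \<Rightarrow> 'b) \<Rightarrow> 'a \<Rightarrow> nat \<Rightarrow> ('a \<Rightarrow> 'b)" where
  "rotor_config_at G m \<rho> x0 t = snd (rotor_state G m \<rho> x0 t)"

text \<open>
  The arc along which the walk moves from its position at time \<open>t\<close> to its position at time
  \<open>t + 1\<close>. Without parallel arcs it is determined by the pair of these two vertices, see
  \<open>edges_covered_iff_pairs\<close> below.
\<close>

definition rotor_walk_arc ::
  "('a, 'b) pre_digraph \<Rightarrow> ('a \<Rightarrow> 'b \<Rightarrow> 'b) \<Rightarrow> ('a \<Rightarrow> 'b) \<Rightarrow> 'a \<Rightarrow> nat \<Rightarrow> 'b" where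
  "rotor_walk_arc G m \<rho> x0 t = rotor_config_at G m \<rho> x0 (Suc t) (rotor_walk G m \<rho> x0 t)"

text \<open>The cover times are \<open>\<infinity>\<close> if the walk never covers.\<close>

definition vertex_cover_time ::
  "('a, 'b) pre_digraph \<Rightarrow> ('a \<Rightarrow> 'b \<Rightarrow> 'b) \<Rightarrow> ('a \<Rightarrow> 'b) \<Rightarrow> 'a \<Rightarrow> enat" where
  "vertex_cover_time G m \<rho> x0 = (INF t \<in> {t. rotor_walk G m \<rho> x0 ` {1..t} = verts G}. enat t)"

definition edge_cover_time ::
  "('a, 'b) pre_digraph \<Rightarrow> ('a \<Rightarrow> 'b \<Rightarrow> 'b) \<Rightarrow> ('a \<Rightarrow> 'b) \<Rightarrow> 'a \<Rightarrow> enat" where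
  "edge_cover_time G m \<rho> x0 = (INF t \<in> {t. rotor_walk_arc G m \<rho> x0 ` {0..t} = arcs G}. enat t)"


lemma (in wf_digraph) digraph_dist_eq_\<mu>: "ereal_of_enat (digraph_dist G x y) = \<mu> (\<lambda>_. 1) x y"
proof -
  have c: "awalk_cost (\<lambda>_. 1) p = real (length p)" for p
    by (induction p) auto
  show ?thesis
  proof (cases "{p. awalk x p y} = {}")
    case True
    then show ?thesis unfolding digraph_dist_def \<mu>_def True by (simp add: top_enat_def top_ereal_def)
  next
    case False
    let ?A = "(\<lambda>p. enat (length p)) ` {p. awalk x p y}"
    have "Inf ?A \<in> ?A"
      using False by (metis (no_types, lifting) ex_in_conv image_is_empty wellorder_InfI)
    then obtain q where q: "awalk x q y" "digraph_dist G x y = enat (length q)"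
      unfolding digraph_dist_def by auto
    have "length q \<le> length p" if "awalk x p y" for p
    proof -
      have "digraph_dist G x y \<le> enat (length p)"
        unfolding digraph_dist_def using that by (intro INF_lower) auto
      then show ?thesis using q(2) by simp
    qed
    then have "ereal (length q) \<le> \<mu> (\<lambda>_. 1) x y"
      unfolding \<mu>_def c by (intro INF_greatest) auto
    moreover have "\<mu> (\<lambda>_. 1) x y \<le> ereal (length q)"
      using min_cost_le_walk_cost[OF q(1), of "\<lambda>_. 1"] by (simp add: c)
    ultimately have "\<mu> (\<lambda>_. 1) x y = ereal (length q)" by (rule antisym[rotated])
    then show ?thesis using q(2) by simp
  qed
qed

lemma rotor_walk_simps:
  "rotor_walk G m \<rho> x0 0 = x0"
  "rotor_config_at G m \<rho> x0 0 = \<rho>"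
  "rotor_config_at G m \<rho> x0 (Suc t) (rotor_walk G m \<rho> x0 t) =
     m (rotor_walk G m \<rho> x0 t) (rotor_config_at G m \<rho> x0 t (rotor_walk G m \<rho> x0 t))"
  "v \<noteq> rotor_walk G m \<rho> x0 t \<Longrightarrow>
     rotor_config_at G m \<rho> x0 (Suc t) v = rotor_config_at G m \<rho> x0 t v"
  "rotor_walk G m \<rho> x0 (Suc t) =
     head G (rotor_config_at G m \<rho> x0 (Suc t) (rotor_walk G m \<rho> x0 t))"
  by (auto simp: rotor_walk_def rotor_config_at_def Let_def split: prod.splits)

context wf_digraph
begin

lemma rotor_walk_invariant:
  assumes "rotor_mechanism G m" "rotor_configuration G \<rho>" "x0 \<in> verts G"
  shows "rotor_walk G m \<rho> x0 t \<in> verts G \<and> rotor_configuration G (rotor_config_at G m \<rho> x0 t)"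
proof (induction t)
  case 0
  then show ?case using assms by (simp add: rotor_walk_simps)
next
  case (Suc t)
  let ?x = "rotor_walk G m \<rho> x0 t" and ?r = "rotor_config_at G m \<rho> x0"
  have "m ?x (?r t ?x) \<in> out_arcs G ?x"
    using Suc assms(1) unfolding rotor_mechanism_def rotor_configuration_def
    by (meson cyclic_on_inI)
  then have new: "?r (Suc t) ?x \<in> out_arcs G ?x"
    by (simp add: rotor_walk_simps(3))
  have "?r (Suc t) v \<in> out_arcs G v" if "v \<in> verts G" for v
    using new Suc that rotor_walk_simps(4)[of v G m \<rho> x0 t]
    by (cases "v = ?x") (auto simp: rotor_configuration_def)
  then show ?case
    using new by (auto simp: rotor_configuration_def rotor_walk_simps(5))
qed

lemma rotor_walk_arc:
  assumes "rotor_mechanism G m" "rotor_configuration G \<rho>" "x0 \<in> verts G"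
  shows "rotor_walk_arc G m \<rho> x0 t \<in> arcs G"
    and "arc_to_ends G (rotor_walk_arc G m \<rho> x0 t)
       = (rotor_walk G m \<rho> x0 t, rotor_walk G m \<rho> x0 (Suc t))"
  using rotor_walk_invariant[OF assms, of t] rotor_walk_invariant[OF assms, of "Suc t"]
  by (auto simp: rotor_walk_arc_def rotor_configuration_def arc_to_ends_def rotor_walk_simps(5))

end

lemma (in nomulti_digraph) edges_covered_iff_pairs:
  assumes "rotor_mechanism G m" "rotor_configuration G \<rho>" "x0 \<in> verts G"
  shows "rotor_walk_arc G m \<rho> x0 ` {0..t} = arcs G \<longleftrightarrow>
    (\<lambda>s. (rotor_walk G m \<rho> x0 s, rotor_walk G m \<rho> x0 (Suc s))) ` {0..t} = arcs_ends G"
proof -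
  have "(\<lambda>s. (rotor_walk G m \<rho> x0 s, rotor_walk G m \<rho> x0 (Suc s))) ` {0..t}
      = arc_to_ends G ` rotor_walk_arc G m \<rho> x0 ` {0..t}"
    by (simp add: image_image rotor_walk_arc(2)[OF assms])
  moreover have "rotor_walk_arc G m \<rho> x0 ` {0..t} \<subseteq> arcs G"
    using rotor_walk_arc(1)[OF assms] by auto
  ultimately show ?thesis
    using inj_on_image_eq_iff[OF inj_on_arc_to_ends] by (simp add: arcs_ends_def)
qed

text \<open>
  Without loops, a digraph carrying a rotor configuration has at least two vertices. With loops,
  one vertex is possible; the diameter is then \<open>0\<close>, while no \<open>t = 0\<close> covers the vertex, because
  \<open>{1..0}\<close> is empty.
\<close>

lemma (in loopfree_digraph) rotor_configuration_two_verts: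
  assumes "finite (verts G)" "verts G \<noteq> {}" "rotor_configuration G \<rho>"
  shows "2 \<le> card (verts G)"
proof -
  obtain v where v: "v \<in> verts G" using assms(2) by auto
  then have e: "\<rho> v \<in> arcs G" "tail G (\<rho> v) = v"
    using assms(3) by (auto simp: rotor_configuration_def)
  have "card {v, head G (\<rho> v)} \<le> card (verts G)"
    using v e assms(1) by (intro card_mono) auto
  then show ?thesis using no_loops[OF e(1)] e(2) by auto
qed

lemma single_vertex_counterexample:
  fixes G :: "('a, 'b) pre_digraph"
  assumes "verts G = {x0}"
  shows "digraph_diameter G = 0" and "vertex_cover_time G m \<rho> x0 \<noteq> 0"
proof -
  have "pre_digraph.awalk G x0 [] x0"
    using assms by (simp add: pre_digraph.awalk_def pre_digraph.cas.simps)
  then have "digraph_dist G x0 x0 \<le> enat (length ([] :: 'b list))"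
    unfolding digraph_dist_def by (intro INF_lower) auto
  then show "digraph_diameter G = 0"
    using assms by (simp add: digraph_diameter_def zero_enat_def[symmetric])
  have "1 \<le> vertex_cover_time G m \<rho> x0"
    unfolding vertex_cover_time_def
  proof (rule INF_greatest)
    fix t assume "t \<in> {t. rotor_walk G m \<rho> x0 ` {1..t} = verts G}"
    then have "t \<noteq> 0" using assms by (intro notI) auto
    then show "1 \<le> enat t" by (simp add: one_enat_def)
  qed
  then show "vertex_cover_time G m \<rho> x0 \<noteq> 0" by auto
qed

end

theory Submission
  imports Defs
begin

text \<open>
  Cut the walk into rounds: a round ends just before the first step that repeats an arc of that
  round. At a vertex other than \<open>x0\<close>, a repeated out-arc would need more entries than there are
  in-arcs, so every round is a closed walk at \<open>x0\<close> using all out-arcs of \<open>x0\<close>, and it has at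
  most \<open>#E\<close> steps. A round is balanced at each vertex, so it uses all in-arcs of a vertex if and
  only if it uses all out-arcs. The last exits of a round form a tree oriented towards \<open>x0\<close>, and
  each of them is the last arc at its tail to be used in the next round; going down this tree, the
  next round uses all out-arcs of every vertex visited before. Hence the \<open>n + 1\<close>-st round
  uses all out-arcs of the ball of radius \<open>n\<close> around \<open>x0\<close>: take \<open>n = D\<close> for the edges and
  \<open>n = D - 1\<close> for the vertices.
\<close>

section \<open>Repetitions in cyclic orbits, and restarting the walk\<close>

text \<open>A return after \<open>j - i\<close> steps closes the orbit, so these steps already run
  through all of \<open>S\<close>.\<close>

lemma cyclic_on_repeat_card_le:
  assumes "cyclic_on f S" "x \<in> S" "i < j" "(f ^^ i) x = (f ^^ j) x"
  shows "card S \<le> j - i"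
proof -
  have "(f ^^ (j - i)) ((f ^^ i) x) = (f ^^ i) x"
    using assms(3,4) by (metis funpow_add le_add_diff_inverse2 less_imp_le o_apply)
  moreover have "S = orbit f ((f ^^ i) x)"
    using orbit_cyclic_eq3[OF assms(1) cyclic_on_funpow_in[OF assms(1,2)]] by simp
  ultimately have "S = (\<lambda>k. (f ^^ k) ((f ^^ i) x)) ` {..<j - i}"
    using assms(3) orbit_altdef_bounded[of "j - i" f "(f ^^ i) x"] by auto
  then show ?thesis
    by (metis card_lessThan finite_lessThan surj_card_le subset_refl)
qed

text \<open>Position and configuration together determine the future. This makes each round a rotor
  walk of its own, started from the current configuration.\<close>

lemma rotor_state_add:
  "rotor_state G m \<rho> x (s + t) =
    rotor_state G m (rotor_config_at G m \<rho> x s) (rotor_walk G m \<rho> x s) t"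
  by (induction t) (simp_all add: rotor_walk_def rotor_config_at_def)

lemma rotor_walk_add:
  "rotor_walk G m \<rho> x (s + t) =
    rotor_walk G m (rotor_config_at G m \<rho> x s) (rotor_walk G m \<rho> x s) t"
  by (simp add: rotor_walk_def rotor_state_add)

lemma rotor_config_at_add:
  "rotor_config_at G m \<rho> x (s + t) =
    rotor_config_at G m (rotor_config_at G m \<rho> x s) (rotor_walk G m \<rho> x s) t"
  by (simp add: rotor_config_at_def rotor_state_add)

lemma rotor_walk_arc_add:
  "rotor_walk_arc G m \<rho> x (s + t) =
    rotor_walk_arc G m (rotor_config_at G m \<rho> x s) (rotor_walk G m \<rho> x s) t"
  by (metis add_Suc_right rotor_config_at_add rotor_walk_add rotor_walk_arc_def)

section \<open>Counting departures and arrivals\<close>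

definition visits :: "(nat \<Rightarrow> 'a) \<Rightarrow> 'a \<Rightarrow> nat \<Rightarrow> nat" where
  "visits X v t = card {s. s < t \<and> X s = v}"

lemma visits_0 [simp]: "visits X v 0 = 0"
  by (simp add: visits_def)

lemma visits_Suc: "visits X v (Suc t) = visits X v t + (if X t = v then 1 else 0)"
proof -
  have "{s. s < Suc t \<and> X s = v} = {s. s < t \<and> X s = v} \<union> (if X t = v then {t} else {})"
    by (auto simp: less_Suc_eq)
  then show ?thesis by (auto simp: visits_def)
qed

lemma visits_mono: "s \<le> t \<Longrightarrow> visits X v s \<le> visits X v t"
  by (auto simp: visits_def intro: card_mono)

lemma visits_less: "s < t \<Longrightarrow> X s = v \<Longrightarrow> visits X v s < visits X v t"
  using visits_mono[of "Suc s" t X v] by (simp add: visits_Suc)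

text \<open>The shifted sequence counts arrivals at \<open>v\<close>, the original one departures;
  the two differ only at the ends. Applied to a rotor walk, this compares used in-arcs with used
  out-arcs.\<close>

lemma visits_shift:
  "visits (\<lambda>s. X (Suc s)) v t + (if X 0 = v then 1 else 0) = visits X v t + (if X t = v then 1 else 0)"
  by (induction t) (auto simp: visits_Suc)

section \<open>Rounds of the rotor walk\<close>

locale rotor_network = fin_digraph G for G :: "('a, 'b) pre_digraph" +
  fixes m :: "'a \<Rightarrow> 'b \<Rightarrow> 'b" and x0 :: 'a
  assumes eulerian: "eulerian_digraph G"
    and mechanism: "rotor_mechanism G m"
    and start: "x0 \<in> verts G"
begin

abbreviation "walk \<rho> \<equiv> rotor_walk G m \<rho> x0"
abbreviation "config \<rho> \<equiv> rotor_config_at G m \<rho> x0"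
abbreviation "warc \<rho> \<equiv> rotor_walk_arc G m \<rho> x0"

text \<open>For a rotor configuration \<open>\<rho>\<close> these conditions make \<open>T\<close>
  the first step that repeats an arc: the walk stands at \<open>x0\<close> with all out-arcs of
  \<open>x0\<close> already used.\<close>

definition rotor_round :: "('a \<Rightarrow> 'b) \<Rightarrow> nat \<Rightarrow> bool" where
  "rotor_round \<rho> T \<longleftrightarrow> T \<le> card (arcs G) \<and> walk \<rho> T = x0 \<and>
    inj_on (warc \<rho>) {..<T} \<and> out_arcs G x0 \<subseteq> warc \<rho> ` {..<T}"

lemma cyclic_mechanism: "v \<in> verts G \<Longrightarrow> cyclic_on (m v) (out_arcs G v)"
  using mechanism by (simp add: rotor_mechanism_def)

lemma card_in_arcs: "v \<in> verts G \<Longrightarrow> card (in_arcs G v) = card (out_arcs G v)"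
  using eulerian by (simp add: eulerian_digraph_def in_degree_def out_degree_def)

lemma config_eq: "config \<rho> t v = (m v ^^ visits (walk \<rho>) v t) (\<rho> v)"
proof (induction t)
  case 0
  then show ?case by (simp add: rotor_walk_simps)
next
  case (Suc t)
  then show ?case
    by (cases "walk \<rho> t = v")
      (auto simp: visits_Suc rotor_walk_simps(3) rotor_walk_simps(4))
qed

text \<open>\<open>Suc\<close> appears because the rotor turns before the walk moves. Hence the
  initial rotor of a vertex comes last in its cycle of out-arcs.\<close>

lemma warc_eq: "warc \<rho> t = (m (walk \<rho> t) ^^ Suc (visits (walk \<rho>) (walk \<rho> t) t)) (\<rho> (walk \<rho> t))"
  by (simp add: rotor_walk_arc_def config_eq visits_Suc)

context
  fixes \<rho> :: "'a \<Rightarrow> 'b"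
  assumes \<rho>: "rotor_configuration G \<rho>"
begin

lemma walk_in_verts: "walk \<rho> t \<in> verts G"
  and config_rotor_configuration: "rotor_configuration G (config \<rho> t)"
  using rotor_walk_invariant[OF mechanism \<rho> start] by auto

lemma warc_in_arcs: "warc \<rho> t \<in> arcs G"
  and tail_warc: "tail G (warc \<rho> t) = walk \<rho> t"
  and head_warc: "head G (warc \<rho> t) = walk \<rho> (Suc t)"
  using rotor_walk_arc[OF mechanism \<rho> start] by (auto simp: arc_to_ends_def)

lemma visits_eq_card_out:
  assumes "inj_on (warc \<rho>) {..<t}"
  shows "visits (walk \<rho>) v t = card (warc \<rho> ` {..<t} \<inter> out_arcs G v)"
proof -
  have "warc \<rho> ` {..<t} \<inter> out_arcs G v = warc \<rho> ` {s. s < t \<and> walk \<rho> s = v}"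
    using warc_in_arcs tail_warc by auto
  moreover have "inj_on (warc \<rho>) {s. s < t \<and> walk \<rho> s = v}"
    using assms by (rule inj_on_subset) auto
  ultimately show ?thesis by (simp add: visits_def card_image)
qed

lemma visits_Suc_eq_card_in:
  assumes "inj_on (warc \<rho>) {..<t}"
  shows "visits (\<lambda>s. walk \<rho> (Suc s)) v t = card (warc \<rho> ` {..<t} \<inter> in_arcs G v)"
proof -
  have "warc \<rho> ` {..<t} \<inter> in_arcs G v = warc \<rho> ` {s. s < t \<and> walk \<rho> (Suc s) = v}"
    using warc_in_arcs head_warc by auto
  moreover have "inj_on (warc \<rho>) {s. s < t \<and> walk \<rho> (Suc s) = v}"
    using assms by (rule inj_on_subset) auto
  ultimately show ?thesis by (simp add: visits_def card_image)
qed

lemma out_arcs_subset_if_visits: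
  assumes "inj_on (warc \<rho>) {..<t}" "card (out_arcs G v) \<le> visits (walk \<rho>) v t"
  shows "out_arcs G v \<subseteq> warc \<rho> ` {..<t}"
proof -
  have "warc \<rho> ` {..<t} \<inter> out_arcs G v = out_arcs G v"
    using assms visits_eq_card_out[OF assms(1), of v] by (intro card_seteq) auto
  then show ?thesis by auto
qed

lemma rotor_round_exists: "\<exists>T. rotor_round \<rho> T"
proof -
  let ?P = "\<lambda>t. warc \<rho> t \<in> warc \<rho> ` {..<t}"
  have inj: "inj_on (warc \<rho>) {..<t}" if "\<forall>s<t. \<not> ?P s" for t
  proof (rule linorder_inj_onI)
    fix r s assume "r < s" "s \<in> {..<t}"
    then have "warc \<rho> s \<notin> warc \<rho> ` {..<s}" "warc \<rho> r \<in> warc \<rho> ` {..<s}"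
      using that by auto
    then show "warc \<rho> r \<noteq> warc \<rho> s" by auto
  qed auto
  have le: "t \<le> card (arcs G)" if "inj_on (warc \<rho>) {..<t}" for t
    using card_inj_on_le[OF that, of "arcs G"] warc_in_arcs by auto
  \<comment> \<open>Pigeonhole: without a repetition, the first \<open>Suc (card (arcs G))\<close>
    steps would use distinct arcs.\<close>
  have "\<exists>t. ?P t"
    using le[OF inj[of "Suc (card (arcs G))"]] by (meson Suc_n_not_le_n)
  then obtain T where T: "?P T" "\<forall>t<T. \<not> ?P t"
    using exists_least_iff[of ?P] by blast
  note injT = inj[OF T(2)]
  obtain s where s: "s < T" "warc \<rho> s = warc \<rho> T" using T(1) by auto
  define v where "v = walk \<rho> T"
  have v: "v \<in> verts G" "walk \<rho> s = v"
    using walk_in_verts tail_warc s(2) unfolding v_def by metis+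
  have "\<rho> v \<in> out_arcs G v"
    using \<rho> v(1) by (auto simp: rotor_configuration_def)
  moreover have "visits (walk \<rho>) v s < visits (walk \<rho>) v T"
    using s(1) v(2) by (rule visits_less)
  then have "Suc (visits (walk \<rho>) v s) < Suc (visits (walk \<rho>) v T)" by simp
  moreover have "(m v ^^ Suc (visits (walk \<rho>) v s)) (\<rho> v) = (m v ^^ Suc (visits (walk \<rho>) v T)) (\<rho> v)"
    using s(2) unfolding warc_eq v(2) v_def[symmetric] .
  \<comment> \<open>Steps \<open>s\<close> and \<open>T\<close> leave \<open>v\<close> by the same
    arc, so the rotor at \<open>v\<close> makes at least one full turn between them.\<close>
  ultimately have "card (out_arcs G v) \<le> Suc (visits (walk \<rho>) v T) - Suc (visits (walk \<rho>) v s)"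
    by (rule cyclic_on_repeat_card_le[OF cyclic_mechanism[OF v(1)]])
  then have full: "card (out_arcs G v) \<le> visits (walk \<rho>) v T" by simp
  \<comment> \<open>Arrivals at \<open>v\<close> use distinct in-arcs, so they do not outnumber the
    departures. As the walk is at \<open>v\<close> at time \<open>T\<close>,
    \<open>visits_shift\<close> forces it to have started there.\<close>
  have "visits (\<lambda>s. walk \<rho> (Suc s)) v T \<le> card (out_arcs G v)"
    unfolding visits_Suc_eq_card_in[OF injT] card_in_arcs[OF v(1), symmetric]
    by (intro card_mono) auto
  then have "walk \<rho> 0 = v"
    using full visits_shift[of "walk \<rho>" v T] v_def by (auto split: if_splits)
  then have "v = x0" by (simp add: rotor_walk_simps)
  then have "rotor_round \<rho> T"
    using le[OF injT] injT out_arcs_subset_if_visits[OF injT full] v_def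
    by (simp add: rotor_round_def)
  then show ?thesis ..
qed

text \<open>A round is a closed walk without repeated arcs, so it uses as many in-arcs of
  \<open>v\<close> as out-arcs, and the two degrees agree.\<close>

lemma rotor_round_balanced:
  assumes "rotor_round \<rho> T" "v \<in> verts G" "out_arcs G v \<subseteq> warc \<rho> ` {..<T}"
  shows "in_arcs G v \<subseteq> warc \<rho> ` {..<T}"
proof -
  have inj: "inj_on (warc \<rho>) {..<T}" and T: "walk \<rho> T = x0"
    using assms(1) by (auto simp: rotor_round_def)
  have "warc \<rho> ` {..<T} \<inter> out_arcs G v = out_arcs G v"
    using assms(3) by auto
  then have "card (in_arcs G v) = card (warc \<rho> ` {..<T} \<inter> in_arcs G v)"
    using visits_shift[of "walk \<rho>" v T] T card_in_arcs[OF assms(2)]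
    unfolding visits_eq_card_out[OF inj] visits_Suc_eq_card_in[OF inj]
    by (simp add: rotor_walk_simps)
  then have "warc \<rho> ` {..<T} \<inter> in_arcs G v = in_arcs G v"
    by (intro card_seteq) auto
  then show ?thesis by auto
qed

text \<open>The rotor at \<open>v\<close> comes back to its initial arc only by completing a full
  turn.\<close>

lemma rotor_round_initial_arc:
  assumes "rotor_round \<rho> T" "v \<in> verts G" "\<rho> v \<in> warc \<rho> ` {..<T}"
  shows "out_arcs G v \<subseteq> warc \<rho> ` {..<T}"
proof -
  have inj: "inj_on (warc \<rho>) {..<T}"
    using assms(1) by (auto simp: rotor_round_def)
  obtain s where s: "s < T" "\<rho> v = warc \<rho> s" using assms(3) by auto
  have \<rho>v: "\<rho> v \<in> out_arcs G v"
    using \<rho> assms(2) by (auto simp: rotor_configuration_def)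
  then have v: "walk \<rho> s = v"
    using s(2) tail_warc[of s] by auto
  then have "(m v ^^ 0) (\<rho> v) = (m v ^^ Suc (visits (walk \<rho>) v s)) (\<rho> v)"
    using s(2) warc_eq[of \<rho> s] by simp
  then have "card (out_arcs G v) \<le> Suc (visits (walk \<rho>) v s) - 0"
    by (rule cyclic_on_repeat_card_le[OF cyclic_mechanism[OF assms(2)] \<rho>v zero_less_Suc])
  then have "card (out_arcs G v) \<le> Suc (visits (walk \<rho>) v s)" by simp
  also have "\<dots> \<le> visits (walk \<rho>) v T"
    using visits_less[where X = "walk \<rho>", OF s(1) v] by simp
  finally show ?thesis by (rule out_arcs_subset_if_visits[OF inj])
qed

end

text \<open>Induction backwards in time from \<open>T\<close>, where the walk is at
  \<open>x0\<close>, replaces an explicit tree of last exits: only the last visit to a vertex needs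
  an argument, and its exit leads to a later position.\<close>

lemma next_round_full:
  assumes \<rho>: "rotor_configuration G \<rho>" and T: "walk \<rho> T = x0"
    and round: "rotor_round (config \<rho> T) T'" and "s \<le> T"
  shows "out_arcs G (walk \<rho> s) \<subseteq> warc (config \<rho> T) ` {..<T'}" (is "_ \<subseteq> ?B")
  using \<open>s \<le> T\<close>
proof (induction "T - s" arbitrary: s rule: less_induct)
  case less
  let ?v = "walk \<rho> s"
  note next_config = config_rotor_configuration[OF \<rho>, of T]
  consider "s = T" | r where "s < r" "r \<le> T" "walk \<rho> r = ?v"
    | "s < T" "\<And>r. s < r \<Longrightarrow> r \<le> T \<Longrightarrow> walk \<rho> r \<noteq> ?v"
    using less.prems by fastforce
  then show ?case
  proof cases
    case 1
    then show ?thesis using round T by (simp add: rotor_round_def)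
  next
    case 2
    then show ?thesis using less.hyps[of r] by simp
  next
    case 3
    \<comment> \<open>After the last exit at time \<open>s\<close> the rotor at \<open>?v\<close>
      stays put, so at time \<open>T\<close> it still points along the arc of step
      \<open>s\<close>.\<close>
    then have "{r. r < T \<and> walk \<rho> r = ?v} = {r. r < Suc s \<and> walk \<rho> r = ?v}"
      by (auto simp: less_Suc_eq_le) (metis less_imp_le_nat linorder_not_less)
    then have "config \<rho> T ?v = warc \<rho> s"
      by (simp add: rotor_walk_arc_def config_eq visits_def)
    \<comment> \<open>That arc enters \<open>walk \<rho> (Suc s)\<close>, a position closer to
      \<open>T\<close>. The induction hypothesis and balance put it into the next round, whose
      initial rotor at \<open>?v\<close> it is.\<close>
    have "out_arcs G (walk \<rho> (Suc s)) \<subseteq> ?B"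
      using 3(1) less.hyps[of "Suc s"] by simp
    then have "in_arcs G (walk \<rho> (Suc s)) \<subseteq> ?B"
      by (intro rotor_round_balanced[OF next_config round walk_in_verts[OF \<rho>]])
    then have "config \<rho> T ?v \<in> ?B"
      using \<open>config \<rho> T ?v = warc \<rho> s\<close> warc_in_arcs[OF \<rho>, of s] head_warc[OF \<rho>, of s] by auto
    then show ?thesis
      by (intro rotor_round_initial_arc[OF next_config round walk_in_verts[OF \<rho>]])
  qed
qed

section \<open>Growth of the covered ball\<close>

text \<open>Balls are given by walks of bounded length instead of \<open>digraph_dist\<close>, so
  that a last arc can be split off and no infimum is involved.\<close>

definition covers_ball :: "('a \<Rightarrow> 'b) \<Rightarrow> nat \<Rightarrow> nat \<Rightarrow> bool" where
  "covers_ball \<rho> n t \<longleftrightarrow>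
    (\<forall>v p. awalk x0 p v \<longrightarrow> length p \<le> n \<longrightarrow> out_arcs G v \<subseteq> warc \<rho> ` {..<t})"

lemma covers_ballD:
  "covers_ball \<rho> n t \<Longrightarrow> awalk x0 p v \<Longrightarrow> length p \<le> n \<Longrightarrow> out_arcs G v \<subseteq> warc \<rho> ` {..<t}"
  unfolding covers_ball_def by blast

text \<open>The last arc of \<open>p\<close> leaves a vertex of the ball of radius \<open>n\<close>,
  hence is used, and its use leads to \<open>v\<close>. This gains one unit of radius, both for the
  next round and for the vertex cover.\<close>

lemma covers_ball_visits_next:
  assumes \<rho>: "rotor_configuration G \<rho>" and ball: "covers_ball \<rho> n t"
    and p: "awalk x0 p v" "length p \<le> Suc n" "p \<noteq> []"
  obtains s where "s < t" "walk \<rho> (Suc s) = v"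
proof -
  obtain q e where qe: "p = q @ [e]" using p(3) rev_exhaust by blast
  then have q: "awalk x0 q (tail G e)" "e \<in> arcs G" "head G e = v"
    using p(1) by (auto simp: awalk_simps)
  then have "e \<in> warc \<rho> ` {..<t}"
    using covers_ballD[OF ball q(1)] qe p(2) by auto
  then obtain s where "s < t" "e = warc \<rho> s" by auto
  then show ?thesis
    using that q(3) head_warc[OF \<rho>] by auto
qed

text \<open>In the induction, \<open>S\<close> and \<open>T\<close> are the start and the length of
  the latest round. Each further round costs at most \<open>card (arcs G)\<close> steps and raises
  the radius by one.\<close>

lemma round_covers_ball:
  assumes \<rho>: "rotor_configuration G \<rho>"
  shows "\<exists>S T. S + T \<le> Suc n * card (arcs G) \<and> walk \<rho> S = x0 \<and> rotor_round (config \<rho> S) T \<and>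
    covers_ball (config \<rho> S) n T"
proof (induction n)
  case 0
  obtain T where T: "rotor_round \<rho> T"
    using rotor_round_exists[OF \<rho>] by auto
  then have "T \<le> card (arcs G)" "out_arcs G x0 \<subseteq> warc \<rho> ` {..<T}"
    by (auto simp: rotor_round_def)
  then have "covers_ball \<rho> 0 T"
    by (auto simp: covers_ball_def awalk_Nil_iff)
  show ?case
  proof (intro exI conjI)
    show "0 + T \<le> Suc 0 * card (arcs G)"
      using \<open>T \<le> card (arcs G)\<close> by simp
  qed (use T \<open>covers_ball \<rho> 0 T\<close> in \<open>simp_all add: rotor_walk_simps\<close>)
next
  case (Suc n)
  then obtain S T where ST: "S + T \<le> Suc n * card (arcs G)" "walk \<rho> S = x0"
      "rotor_round (config \<rho> S) T"
    and ball: "covers_ball (config \<rho> S) n T"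
    by blast
  let ?\<sigma> = "config \<rho> S"
  note \<sigma> = config_rotor_configuration[OF \<rho>, of S]
  have T: "walk ?\<sigma> T = x0"
    using ST(3) by (simp add: rotor_round_def)
  obtain T' where T': "rotor_round (config ?\<sigma> T) T'"
    using rotor_round_exists[OF config_rotor_configuration[OF \<sigma>]] by blast
  have "covers_ball (config ?\<sigma> T) (Suc n) T'"
    unfolding covers_ball_def
  proof (intro allI impI)
    fix v p assume p: "awalk x0 p v" "length p \<le> Suc n"
    have "\<exists>s\<le>T. walk ?\<sigma> s = v"
    proof (cases "p = []")
      \<comment> \<open>The centre \<open>x0\<close> is reached by no last arc of \<open>p\<close>,
        but the round returns to it at time \<open>T\<close>.\<close>
      case True
      then show ?thesis using p(1) T by (auto simp: awalk_Nil_iff)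
    next
      case False
      obtain s where "s < T" "walk ?\<sigma> (Suc s) = v"
        using covers_ball_visits_next[OF \<sigma> ball p False] .
      then show ?thesis by (intro exI[of _ "Suc s"]) auto
    qed
    then show "out_arcs G v \<subseteq> warc (config ?\<sigma> T) ` {..<T'}"
      using next_round_full[OF \<sigma> T T'] by blast
  qed
  show ?case
  proof (intro exI conjI)
    show "(S + T) + T' \<le> Suc (Suc n) * card (arcs G)"
      using ST(1) T' by (simp add: rotor_round_def)
    show "walk \<rho> (S + T) = x0"
      using T by (simp add: rotor_walk_add ST(2))
    have "config \<rho> (S + T) = config ?\<sigma> T"
      by (simp add: rotor_config_at_add ST(2))
    then show "rotor_round (config \<rho> (S + T)) T'" "covers_ball (config \<rho> (S + T)) (Suc n) T'"
      using T' \<open>covers_ball (config ?\<sigma> T) (Suc n) T'\<close> by simp_all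
  qed
qed

text \<open>What the last round uses, the whole walk up to its end uses; from here on the rounds can
  be forgotten.\<close>

lemma walk_covers_ball:
  assumes \<rho>: "rotor_configuration G \<rho>"
  obtains t where "t \<le> Suc n * card (arcs G)" "walk \<rho> t = x0" "covers_ball \<rho> n t"
proof -
  obtain S T where ST: "S + T \<le> Suc n * card (arcs G)" "walk \<rho> S = x0"
      "rotor_round (config \<rho> S) T"
    and ball: "covers_ball (config \<rho> S) n T"
    using round_covers_ball[OF \<rho>, of n] by (elim exE conjE) (rule that)
  have "warc (config \<rho> S) ` {..<T} = (\<lambda>s. warc \<rho> (S + s)) ` {..<T}"
    using ST(2) by (simp add: rotor_walk_arc_add)
  then have "warc (config \<rho> S) ` {..<T} \<subseteq> warc \<rho> ` {..<S + T}"
    by auto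
  then have "covers_ball \<rho> n (S + T)"
    using ball unfolding covers_ball_def by (blast intro: subset_trans)
  moreover have "walk \<rho> (S + T) = x0"
    using ST(2,3) by (simp add: rotor_walk_add rotor_round_def)
  ultimately show ?thesis
    using that[OF ST(1)] by simp
qed

section \<open>From the diameter to the cover times\<close>

lemma awalk_of_diameter:
  assumes "digraph_diameter G = enat d" "v \<in> verts G"
  obtains p where "awalk x0 p v" "length p \<le> d"
proof -
  have "digraph_dist G x0 v \<le> digraph_diameter G"
    unfolding digraph_diameter_def using start assms(2) by (meson SUP_upper2 order_refl)
  \<comment> \<open>The strict bound extracts an actual walk from the infimum.\<close>
  then have "digraph_dist G x0 v < enat (Suc d)"
    using assms(1) by (metis enat_ord_simps(2) le_less_trans lessI)
  then obtain p where "awalk x0 p v" "length p < Suc d"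
    unfolding digraph_dist_def by (auto simp: Inf_less_iff)
  then show ?thesis using that by auto
qed

lemma edge_cover_time_le:
  assumes \<rho>: "rotor_configuration G \<rho>"
  shows "edge_cover_time G m \<rho> x0 \<le> (digraph_diameter G + 1) * enat (card (arcs G))"
proof (cases "digraph_diameter G")
  case (enat d)
  obtain t where t: "t \<le> Suc d * card (arcs G)" and ball: "covers_ball \<rho> d t"
    using walk_covers_ball[OF \<rho>] .
  have "arcs G \<subseteq> warc \<rho> ` {0..t}"
  proof
    fix e assume e: "e \<in> arcs G"
    obtain p where p: "awalk x0 p (tail G e)" "length p \<le> d"
      using awalk_of_diameter[OF enat tail_in_verts[OF e]] .
    have "e \<in> warc \<rho> ` {..<t}"
      using covers_ballD[OF ball p] e by auto
    then show "e \<in> warc \<rho> ` {0..t}" by auto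
  qed
  then have "warc \<rho> ` {0..t} = arcs G"
    using warc_in_arcs[OF \<rho>] by auto
  then have "edge_cover_time G m \<rho> x0 \<le> enat t"
    unfolding edge_cover_time_def by (intro INF_lower) simp
  also have "\<dots> \<le> (digraph_diameter G + 1) * enat (card (arcs G))"
    using t enat by (simp add: one_enat_def)
  finally show ?thesis .
next
  case infinity
  \<comment> \<open>In \<open>enat\<close>, infinity times \<open>0\<close> is \<open>0\<close>; a
    single arc makes the right-hand side infinite.\<close>
  have "arcs G \<noteq> {}"
    using \<rho> start by (auto simp: rotor_configuration_def)
  then show ?thesis using infinity by (simp add: imult_is_infinity zero_enat_def)
qed

lemma vertex_cover_time_le:
  assumes \<rho>: "rotor_configuration G \<rho>" and two: "2 \<le> card (verts G)"
  shows "vertex_cover_time G m \<rho> x0 \<le> digraph_diameter G * enat (card (arcs G))"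
proof (cases "digraph_diameter G")
  case (enat d)
  \<comment> \<open>A second vertex forces a positive diameter, which makes the radius
    \<open>n = d - 1\<close> available.\<close>
  have "\<not> verts G \<subseteq> {x0}"
    using two card_mono[of "{x0}" "verts G"] by auto
  then obtain y where y: "y \<in> verts G" "y \<noteq> x0" by blast
  obtain p where "awalk x0 p y" "length p \<le> d"
    using awalk_of_diameter[OF enat y(1)] .
  then have "d \<noteq> 0"
    using y(2) by (cases p) (auto simp: awalk_Nil_iff)
  then obtain n where n: "d = Suc n" using not0_implies_Suc by auto
  obtain t where t: "t \<le> Suc n * card (arcs G)" "walk \<rho> t = x0" and ball: "covers_ball \<rho> n t"
    using walk_covers_ball[OF \<rho>] .
  \<comment> \<open>The vertex \<open>x0\<close> is covered by the return at time \<open>t\<close>,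
    which must be positive to lie in \<open>{1..t}\<close>.\<close>
  have "\<rho> x0 \<in> out_arcs G x0"
    using \<rho> start by (simp add: rotor_configuration_def)
  then have "t \<noteq> 0"
    using covers_ballD[OF ball, of "[]" x0] start by (auto simp: awalk_Nil_iff)
  have "verts G \<subseteq> walk \<rho> ` {1..t}"
  proof
    fix v assume v: "v \<in> verts G"
    obtain p where p: "awalk x0 p v" "length p \<le> Suc n"
      using awalk_of_diameter[OF enat v] unfolding n .
    show "v \<in> walk \<rho> ` {1..t}"
    proof (cases "p = []")
      case True
      then have "v = walk \<rho> t" using p(1) t(2) by (simp add: awalk_Nil_iff)
      then show ?thesis using \<open>t \<noteq> 0\<close> by auto
    next
      case False
      obtain s where "s < t" "walk \<rho> (Suc s) = v"
        using covers_ball_visits_next[OF \<rho> ball p False] .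
      then show ?thesis by (intro image_eqI[of _ _ "Suc s"]) auto
    qed
  qed
  then have "walk \<rho> ` {1..t} = verts G"
    using walk_in_verts[OF \<rho>] by auto
  then have "vertex_cover_time G m \<rho> x0 \<le> enat t"
    unfolding vertex_cover_time_def by (intro INF_lower) simp
  also have "\<dots> \<le> digraph_diameter G * enat (card (arcs G))"
    using t(1) enat n by simp
  finally show ?thesis .
next
  case infinity
  have "arcs G \<noteq> {}"
    using \<rho> start by (auto simp: rotor_configuration_def)
  then show ?thesis using infinity by (simp add: imult_is_infinity zero_enat_def)
qed

end

theorem theorem6p1:
  fixes G :: "('a, 'b) pre_digraph"
    and m :: "'a \<Rightarrow> 'b \<Rightarrow> 'b"
    and \<rho> :: "'a \<Rightarrow> 'b"
    and x0 :: 'a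
  assumes "fin_digraph G"
    and "connected G"
    and "eulerian_digraph G"
    and "rotor_mechanism G m"
    and "rotor_configuration G \<rho>"
    and "x0 \<in> verts G"
  shows "(2 \<le> card (verts G) \<longrightarrow>
            vertex_cover_time G m \<rho> x0 \<le> digraph_diameter G * enat (card (arcs G)))
       \<and> edge_cover_time G m \<rho> x0 \<le> (digraph_diameter G + 1) * enat (card (arcs G))"
proof -
  interpret fin_digraph G by fact
  interpret rotor_network G m x0
    using assms(3,4,6) by unfold_locales
  show ?thesis
    using vertex_cover_time_le[OF assms(5)] edge_cover_time_le[OF assms(5)] by blast
qed

end
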